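(* Let $X$ be a random context in $\mathcal{X}$. Let $w^\star(x)=\sum_{k=1}^K\alpha_k^\star(x)\beta_k^\star$ and $\hat w_{\mathrm{OTSS}}(x)=\sum_{k=1}^K\alpha_k(x)\beta_k$, where $\alpha^\star(x),\alpha(x)\in\Delta^K$ for every $x\in\mathcal{X}$ and $\beta_k^\star,\beta_k\in\mathbb{R}^J$ for $k=1,\dots,K$. Then for every $x\in\mathcal{X}$, $$\hat w_{\mathrm{OTSS}}(x)-w^\star(x)=\sum_{k=1}^K\alpha_k(x)(\beta_k-\beta_k^\star)+\sum_{k=1}^K(\alpha_k(x)-\alpha_k^\star(x))\beta_k^\star .$$ Moreover, with $B_\beta:=\max_{1\le k\le K}\|\beta_k^\star\|_2$, $$\mathbb{E}\left[\|\hat w_{\mathrm{OTSS}}(X)-w^\star(X)\|_2^2\right]\le2\sum_{k=1}^K\mathbb{E}[\alpha_k(X)]\,\|\beta_k-\beta_k^\star\|_2^2+2B_\beta^2\,\mathbb{E}\left[\|\alpha(X)-\alpha^\star(X)\|_1^2\right].$$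
   Context: $\Delta^K=\{\alpha\in\mathbb{R}_+^K:\sum_{k=1}^K\alpha_k=1\}$ is the probability simplex. The maps $\alpha,\alpha^\star:\mathcal{X}\to\Delta^K$ are measurable; expectations are over $X$ with $\alpha$ and $\beta_1,\dots,\beta_K$ fixed. *)

theory Defs
  imports "HOL-Probability.Probability"
begin

definition prob_simplex :: "(real ^ 'k) set" where
  "prob_simplex = {a. (\<forall>k. 0 \<le> a $ k) \<and> (\<Sum>k\<in>UNIV. a $ k) = 1}"

(* The library's norm on real ^ 'k is the Euclidean one. *)
definition l1_norm :: "real ^ 'k \<Rightarrow> real" where
  "l1_norm v = (\<Sum>k\<in>UNIV. \<bar>v $ k\<bar>)"

definition mixture_weights ::
  "('x \<Rightarrow> real ^ 'k) \<Rightarrow> ('k \<Rightarrow> real ^ 'j) \<Rightarrow> 'x \<Rightarrow> real ^ 'j" where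
  "mixture_weights \<alpha> \<beta> x = (\<Sum>k\<in>UNIV. \<alpha> x $ k *\<^sub>R \<beta> k)"

end

theory Submission imports Defs begin

text \<open>
  Adding and subtracting \<open>\<Sum>k. \<alpha> x $ k *\<^sub>R \<beta>s k\<close> splits the error into an estimation and a weighting
  part. After \<open>(a + b)\<^sup>2 \<le> 2 a\<^sup>2 + 2 b\<^sup>2\<close>, Jensen's inequality bounds the first part and the triangle
  inequality the second; both bounds are bounded random variables, so they may be integrated.
\<close>

lemma prob_simplex_nth_bounds:
  assumes "a \<in> prob_simplex"
  shows "0 \<le> a $ k" "a $ k \<le> 1"
proof -
  show "0 \<le> a $ k"
    using assms by (simp add: prob_simplex_def)
  have "a $ k \<le> (\<Sum>i\<in>UNIV. a $ i)"
    using assms by (intro member_le_sum) (auto simp: prob_simplex_def)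
  then show "a $ k \<le> 1"
    using assms by (simp add: prob_simplex_def)
qed

text \<open>Since the weights are nonnegative, the triangle inequality bounds the norm of the
  combination by the weighted mean of the norms. The weights also sum to 1, so Jensen's inequality
  for the convex square moves the square inside the mean.\<close>

lemma norm_convex_combination_power2_le:
  fixes v :: "'k::finite \<Rightarrow> 'a::real_normed_vector"
  assumes "a \<in> prob_simplex"
  shows "(norm (\<Sum>k\<in>UNIV. a $ k *\<^sub>R v k))\<^sup>2 \<le> (\<Sum>k\<in>UNIV. a $ k * (norm (v k))\<^sup>2)"
proof -
  have nn: "0 \<le> a $ k" for k
    using assms by (rule prob_simplex_nth_bounds)
  have "norm (\<Sum>k\<in>UNIV. a $ k *\<^sub>R v k) \<le> (\<Sum>k\<in>UNIV. a $ k * norm (v k))"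
    by (rule order_trans[OF norm_sum]) (simp add: nn)
  then have "(norm (\<Sum>k\<in>UNIV. a $ k *\<^sub>R v k))\<^sup>2 \<le> (\<Sum>k\<in>UNIV. a $ k * norm (v k))\<^sup>2"
    by (intro power_mono) auto
  also have "\<dots> \<le> (\<Sum>k\<in>UNIV. a $ k * (norm (v k))\<^sup>2)"
    using convex_on_sum[OF finite _ convex_power2,
        where S = UNIV and a = "($) a" and y = "\<lambda>k. norm (v k)"] assms nn
    by (simp add: prob_simplex_def)
  finally show ?thesis .
qed

text \<open>The coefficients may have either sign, as differences of two weight vectors do, so the
  triangle inequality leaves their absolute values.\<close>

lemma norm_sum_scaleR_le_l1_norm:
  fixes v :: "'k::finite \<Rightarrow> 'a::real_normed_vector"
  assumes "\<And>k. norm (v k) \<le> B"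
  shows "norm (\<Sum>k\<in>UNIV. a $ k *\<^sub>R v k) \<le> B * l1_norm a"
proof -
  have "norm (\<Sum>k\<in>UNIV. a $ k *\<^sub>R v k) \<le> (\<Sum>k\<in>UNIV. \<bar>a $ k\<bar> * B)"
    by (rule order_trans[OF norm_sum]) (auto intro!: sum_mono mult_left_mono assms)
  then show ?thesis
    by (simp add: l1_norm_def sum_distrib_left mult.commute)
qed

text \<open>Nonnegative reals satisfy |s - t| \<le> s + t, and the entries of \<open>a\<close> and
  of \<open>b\<close> each total 1. The bound serves to make the squared weight error
  integrable.\<close>

lemma l1_norm_diff_prob_simplex_le:
  assumes "a \<in> prob_simplex" "b \<in> prob_simplex"
  shows "l1_norm (a - b) \<le> 2"
proof -
  have "l1_norm (a - b) \<le> (\<Sum>k\<in>UNIV. a $ k + b $ k)"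
    unfolding l1_norm_def
  proof (rule sum_mono)
    fix k
    show "\<bar>(a - b) $ k\<bar> \<le> a $ k + b $ k"
      using prob_simplex_nth_bounds(1)[OF assms(1), of k]
        prob_simplex_nth_bounds(1)[OF assms(2), of k] by simp
  qed
  then show ?thesis
    using assms by (simp add: sum.distrib prob_simplex_def)
qed

lemma l1_norm_nonneg: "0 \<le> l1_norm v"
  by (simp add: l1_norm_def sum_nonneg)

lemma borel_measurable_l1_norm: "l1_norm \<in> borel_measurable borel"
  unfolding l1_norm_def[abs_def]
  by (intro borel_measurable_continuous_onI continuous_intros)

lemma borel_measurable_nth: "(\<lambda>v::real ^ 'k. v $ k) \<in> borel_measurable borel"
  by (intro borel_measurable_continuous_onI continuous_intros)

text \<open>The cross term, weights \<open>\<alpha> x\<close> applied to the vectors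
  \<open>\<beta>s k\<close>, occurs in both sums with opposite signs and cancels.\<close>

lemma mixture_weights_diff:
  "mixture_weights \<alpha> \<beta> x - mixture_weights \<alpha>s \<beta>s x =
     (\<Sum>k\<in>UNIV. \<alpha> x $ k *\<^sub>R (\<beta> k - \<beta>s k)) +
     (\<Sum>k\<in>UNIV. (\<alpha> x $ k - \<alpha>s x $ k) *\<^sub>R \<beta>s k)"
  by (simp add: mixture_weights_def algebra_simps sum.distrib sum_subtractf)

lemma norm_add_power2_le:
  fixes u v :: "'a::real_normed_vector"
  shows "(norm (u + v))\<^sup>2 \<le> 2 * (norm u)\<^sup>2 + 2 * (norm v)\<^sup>2"
proof -
  have "(norm (u + v))\<^sup>2 \<le> (norm u + norm v)\<^sup>2"
    by (intro power_mono norm_triangle_ineq) auto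
  \<comment> \<open>The right side exceeds the left by exactly
    \<open>(norm u - norm v)\<^sup>2\<close>.\<close>
  also have "\<dots> \<le> 2 * (norm u)\<^sup>2 + 2 * (norm v)\<^sup>2"
    using zero_le_power2[of "norm u - norm v"]
    by (simp add: power2_sum power2_diff)
  finally show ?thesis .
qed

text \<open>The pointwise form of the risk bound: the main theorem only has to take expectations of
  both sides. Jensen handles the term with \<open>\<beta> k - \<beta>s k\<close>, the l1 bound the
  term with \<open>\<alpha> x - \<alpha>s x\<close>, and each factor 2 comes from
  \<open>norm_add_power2_le\<close>.\<close>

lemma mixture_weights_error_bound:
  assumes "\<alpha> x \<in> prob_simplex" and "\<And>k. norm (\<beta>s k) \<le> B"
  shows "(norm (mixture_weights \<alpha> \<beta> x - mixture_weights \<alpha>s \<beta>s x))\<^sup>2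
    \<le> 2 * (\<Sum>k\<in>UNIV. \<alpha> x $ k * (norm (\<beta> k - \<beta>s k))\<^sup>2) + 2 * B\<^sup>2 * (l1_norm (\<alpha> x - \<alpha>s x))\<^sup>2"
proof -
  have "(norm (\<Sum>k\<in>UNIV. (\<alpha> x $ k - \<alpha>s x $ k) *\<^sub>R \<beta>s k))\<^sup>2 \<le> (B * l1_norm (\<alpha> x - \<alpha>s x))\<^sup>2"
    using norm_sum_scaleR_le_l1_norm[of \<beta>s B "\<alpha> x - \<alpha>s x"] assms(2)
    by (intro power_mono) auto
  then show ?thesis
    using norm_convex_combination_power2_le[OF assms(1), of "\<lambda>k. \<beta> k - \<beta>s k"]
      norm_add_power2_le[of "\<Sum>k\<in>UNIV. \<alpha> x $ k *\<^sub>R (\<beta> k - \<beta>s k)"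
        "\<Sum>k\<in>UNIV. (\<alpha> x $ k - \<alpha>s x $ k) *\<^sub>R \<beta>s k"]
    unfolding mixture_weights_diff by (simp add: power_mult_distrib)
qed

theorem proposition2:
  fixes M :: "'w measure" and N :: "'x measure" and X :: "'w \<Rightarrow> 'x"
    and \<alpha> \<alpha>s :: "'x \<Rightarrow> real ^ 'k" and \<beta> \<beta>s :: "'k \<Rightarrow> real ^ 'j"
    and w_star w_hat :: "'x \<Rightarrow> real ^ 'j" and B :: real
  defines "w_star \<equiv> mixture_weights \<alpha>s \<beta>s"
    and "w_hat \<equiv> mixture_weights \<alpha> \<beta>"
    and "B \<equiv> (MAX k. norm (\<beta>s k))"
  assumes M: "prob_space M"
    and X: "X \<in> M \<rightarrow>\<^sub>M N"
    and \<alpha>_meas: "\<alpha> \<in> borel_measurable N"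
    and \<alpha>s_meas: "\<alpha>s \<in> borel_measurable N"
    and \<alpha>_simplex: "\<forall>x\<in>space N. \<alpha> x \<in> prob_simplex"
    and \<alpha>s_simplex: "\<forall>x\<in>space N. \<alpha>s x \<in> prob_simplex"
  shows "(\<forall>x\<in>space N. w_hat x - w_star x =
            (\<Sum>k\<in>UNIV. \<alpha> x $ k *\<^sub>R (\<beta> k - \<beta>s k)) +
            (\<Sum>k\<in>UNIV. (\<alpha> x $ k - \<alpha>s x $ k) *\<^sub>R \<beta>s k)) \<and>
         prob_space.expectation M (\<lambda>\<omega>. (norm (w_hat (X \<omega>) - w_star (X \<omega>)))\<^sup>2)
           \<le> 2 * (\<Sum>k\<in>UNIV. prob_space.expectation M (\<lambda>\<omega>. \<alpha> (X \<omega>) $ k) * (norm (\<beta> k - \<beta>s k))\<^sup>2)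
             + 2 * B\<^sup>2 * prob_space.expectation M (\<lambda>\<omega>. (l1_norm (\<alpha> (X \<omega>) - \<alpha>s (X \<omega>)))\<^sup>2)"
proof (intro conjI ballI)
  fix x
  show "w_hat x - w_star x =
      (\<Sum>k\<in>UNIV. \<alpha> x $ k *\<^sub>R (\<beta> k - \<beta>s k)) +
      (\<Sum>k\<in>UNIV. (\<alpha> x $ k - \<alpha>s x $ k) *\<^sub>R \<beta>s k)"
    unfolding w_hat_def w_star_def by (rule mixture_weights_diff)
next
  interpret prob_space M by (rule M)
  \<comment> \<open>The simplex hypotheses speak of points of \<open>space N\<close> only;
    measurability of \<open>X\<close> guarantees that it maps \<open>space M\<close> there.\<close>
  have \<alpha>X: "\<alpha> (X \<omega>) \<in> prob_simplex" and \<alpha>sX: "\<alpha>s (X \<omega>) \<in> prob_simplex"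
    if "\<omega> \<in> space M" for \<omega>
    using measurable_space[OF X that] \<alpha>_simplex \<alpha>s_simplex by auto
  have B: "norm (\<beta>s k) \<le> B" for k
    unfolding B_def by (intro Max_ge) auto
  have [measurable]: "(\<lambda>\<omega>. \<alpha> (X \<omega>)) \<in> borel_measurable M" "(\<lambda>\<omega>. \<alpha>s (X \<omega>)) \<in> borel_measurable M"
    using measurable_compose[OF X \<alpha>_meas] measurable_compose[OF X \<alpha>s_meas] by auto
  note [measurable] = measurable_compose[OF _ borel_measurable_nth]
    measurable_compose[OF _ borel_measurable_l1_norm]
  \<comment> \<open>Under a probability measure, bounded measurable functions are integrable;
    coordinates of simplex points lie in [0, 1].\<close>
  have int1: "integrable M (\<lambda>\<omega>. \<alpha> (X \<omega>) $ k)" for k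
    by (rule integrable_const_bound[where B = 1])
      (auto intro!: AE_I2 simp: prob_simplex_nth_bounds[OF \<alpha>X])
  have int2: "integrable M (\<lambda>\<omega>. (l1_norm (\<alpha> (X \<omega>) - \<alpha>s (X \<omega>)))\<^sup>2)"
  proof (rule integrable_const_bound[where B = "2\<^sup>2"])
    show "AE \<omega> in M. norm ((l1_norm (\<alpha> (X \<omega>) - \<alpha>s (X \<omega>)))\<^sup>2) \<le> 2\<^sup>2"
      unfolding real_norm_def abs_power2
      by (intro AE_I2 power_mono l1_norm_diff_prob_simplex_le \<alpha>X \<alpha>sX l1_norm_nonneg)
  qed simp
  let ?bound = "\<lambda>\<omega>. 2 * (\<Sum>k\<in>UNIV. \<alpha> (X \<omega>) $ k * (norm (\<beta> k - \<beta>s k))\<^sup>2)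
    + 2 * B\<^sup>2 * (l1_norm (\<alpha> (X \<omega>) - \<alpha>s (X \<omega>)))\<^sup>2"
  \<comment> \<open>\<open>integral_mono'\<close> asks for integrability of the larger function
    only, together with its nonnegativity: a non-integrable smaller function would have integral 0
    by convention.\<close>
  have "expectation (\<lambda>\<omega>. (norm (w_hat (X \<omega>) - w_star (X \<omega>)))\<^sup>2) \<le> expectation ?bound"
  proof (rule integral_mono')
    show "integrable M ?bound"
      using int1 int2 by simp
    fix \<omega> assume \<omega>: "\<omega> \<in> space M"
    show "(norm (w_hat (X \<omega>) - w_star (X \<omega>)))\<^sup>2 \<le> ?bound \<omega>"
      unfolding w_hat_def w_star_def by (intro mixture_weights_error_bound \<alpha>X \<omega> B)
    show "0 \<le> ?bound \<omega>"
      by (intro add_nonneg_nonneg mult_nonneg_nonneg sum_nonneg)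
        (auto simp: prob_simplex_nth_bounds[OF \<alpha>X[OF \<omega>]])
  qed
  \<comment> \<open>Linearity over the finite sum over \<open>k\<close>, with the constants pulled
    out; \<open>int1\<close> and \<open>int2\<close> make it valid for the Bochner integral.\<close>
  also have "expectation ?bound = 2 * (\<Sum>k\<in>UNIV. expectation (\<lambda>\<omega>. \<alpha> (X \<omega>) $ k) * (norm (\<beta> k - \<beta>s k))\<^sup>2)
    + 2 * B\<^sup>2 * expectation (\<lambda>\<omega>. (l1_norm (\<alpha> (X \<omega>) - \<alpha>s (X \<omega>)))\<^sup>2)"
    using int1 int2 by simp
  finally show "expectation (\<lambda>\<omega>. (norm (w_hat (X \<omega>) - w_star (X \<omega>)))\<^sup>2) \<le>
    2 * (\<Sum>k\<in>UNIV. expectation (\<lambda>\<omega>. \<alpha> (X \<omega>) $ k) * (norm (\<beta> k - \<beta>s k))\<^sup>2)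
    + 2 * B\<^sup>2 * expectation (\<lambda>\<omega>. (l1_norm (\<alpha> (X \<omega>) - \<alpha>s (X \<omega>)))\<^sup>2)" .
qed

end
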